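(* Fix positive integers $t, l, s$ with $1\leq t\leq l< s$, and positive integers $b_1<b_2<\dots<b_t\leq l$, and let $A$ be the ordered alphabet $A=\{b_1<\dots<b_t<l+1<l+2<\dots<s\}$. Then for all $s$ sufficiently large, there exists an infinite sequence of words $w_k$ over $A$ with multiplicities $\mu(w_k)\to\infty$ as $k\to\infty$.
   Context: Words are finite sequences $w=w_1\cdots w_n$ of positive integers. The (regular) continuant $K(w)$ is defined recursively by $K(\text{empty word})=1$, $K(w_1)=w_1$, and $K(w_1\cdots w_j)=w_jK(w_1\cdots w_{j-1})+K(w_1\cdots w_{j-2})$ for $j\geq 2$; equivalently, $K(w)$ is the denominator of the finite regular continued fraction $\frac{1}{w_1+}\frac{1}{w_2+}\cdots\frac{1}{w_{n-1}+}\frac{1}{w_n}$. Since $K(w)=K(\bar w)$ for the reversal $\bar w=w_n\cdots w_1$, each word is identified with its reversal. The Abelian class $\mathcal{X}(w)$ is the set of all permutations (rearrangements) of $w$, with each word identified with its reversal. The multiplicity $\mu(w)$ of $w$ is the number of elements $x\in\mathcal{X}(w)$ with $K(x)=K(w)$, i.e. the number of times the value $K(w)$ occurs in the multiset $\{K(x): x\in\mathcal{X}(w)\}$. *)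

theory Defs
  imports Complex_Main "HOL-Library.Multiset"
begin

function continuant :: "nat list \<Rightarrow> nat" where
  "continuant [] = 1"
| "continuant [a] = a"
| "continuant (w @ [a, b]) = b * continuant (w @ [a]) + continuant w"
proof -
  fix P and x :: "nat list"
  assume 1: "x = [] \<Longrightarrow> P" and 2: "\<And>a. x = [a] \<Longrightarrow> P"
    and 3: "\<And>w a b. x = w @ [a, b] \<Longrightarrow> P"
  show P
  proof (cases x rule: rev_cases)
    case Nil
    then show P by (rule 1)
  next
    case (snoc y b)
    show P
    proof (cases y rule: rev_cases)
      case Nil
      then show P using 2 snoc by simp
    next
      case (snoc w a)
      then show P using 3 \<open>x = y @ [b]\<close> by simp
    qed
  qed
qed simp_all
termination by (relation "measure length") simp_all

lemma continuant_Cons_Cons: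
  "continuant (a # b # w) = a * continuant (b # w) + continuant w"
proof (induction w rule: continuant.induct)
  case 1
  show ?case using continuant.simps(3)[of "[]" a b] by simp
next
  case (2 c)
  show ?case
    using continuant.simps(3)[of "[a]" b c] continuant.simps(3)[of "[]" a b]
      continuant.simps(3)[of "[]" b c]
    by (simp add: algebra_simps)
next
  case (3 w c d)
  then show ?case
    using continuant.simps(3)[of "a # b # w" c d] continuant.simps(3)[of "b # w" c d]
      continuant.simps(3)[of w c d]
    by (simp add: algebra_simps)
qed

lemma continuant_rev: "continuant (rev w) = continuant w"
  by (induction w rule: continuant.induct) (simp_all add: continuant_Cons_Cons)

definition reversal_rel :: "(nat list \<times> nat list) set" where
  "reversal_rel = {(x, y). y = x \<or> y = rev x}"

lemma equiv_reversal_rel: "equiv UNIV reversal_rel"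
  by (auto simp: reversal_rel_def intro!: equivI refl_onI symI transI)

definition abelian_class :: "nat list \<Rightarrow> nat list set set" where
  "abelian_class w = {x. mset x = mset w} // reversal_rel"

(* By continuant_rev, the continuant is constant on each element of abelian_class w. *)
definition word_multiplicity :: "nat list \<Rightarrow> nat" where
  "word_multiplicity w = card {X \<in> abelian_class w. \<exists>x\<in>X. continuant x = continuant w}"

lemma finite_abelian_class: "finite (abelian_class w)"
proof -
  have "{x. mset x = mset w} \<subseteq> {x. set x \<subseteq> set w \<and> length x = length w}"
    using mset_eq_setD mset_eq_length by blast
  then have "finite {x. mset x = mset w}"
    by (rule finite_subset) (simp add: finite_lists_length_eq)
  then show ?thesis
    by (simp add: abelian_class_def quotient_def)
qed

end

theory Submission
  imports Defs "HOL-Library.FuncSet" "HOL-Real_Asymp.Real_Asymp"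
begin

text \<open>
  Only the letters above \<open>l\<close> are needed. Since \<open>K(x) \<le> \<Prod>(x\<^sub>i + 1)\<close>, if all multiplicities are at
  most \<open>M\<close>, then an Abelian class whose words have \<open>P = \<Prod>(x\<^sub>i + 1)\<close> contains at most \<open>2 M P\<close> words.
  Give each word the weight \<open>1 / P\<close>: the words of length \<open>n\<close> over \<open>A\<close> have total weight \<open>c\<^sup>n\<close>, where
  \<open>c = (\<Sum>a\<in>A. 1 / (a + 1))\<close>, and each Abelian class has weight at most \<open>2 M\<close>. As there are at most
  \<open>(n + 1)\<close> to the power \<open>|A|\<close> classes, this is absurd for large \<open>n\<close> as soon as \<open>c > 1\<close>, and the
  divergence of the harmonic series makes \<open>c > 1\<close> for large \<open>s\<close>.
\<close>

lemma continuant_pos: "0 \<notin> set w \<Longrightarrow> continuant w > 0"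
  by (induction w rule: induct_list012) (auto simp: continuant_Cons_Cons)

lemma continuant_le_Cons:
  assumes "0 < a"
  shows "continuant w \<le> continuant (a # w)"
  using assms by (cases w) (auto simp: continuant_Cons_Cons intro: trans_le_add1)

text \<open>Each letter costs one factor: \<open>a * K(bw) + K(w)\<close> is at most
  \<open>(a + 1) * K(bw)\<close>, since prepending a positive letter never lowers the
  continuant.\<close>

lemma continuant_le_prod:
  "0 \<notin> set w \<Longrightarrow> continuant w \<le> (\<Prod>a\<leftarrow>w. Suc a)"
proof (induction w rule: induct_list012)
  case (3 a b w)
  have "continuant (a # b # w) \<le> Suc a * continuant (b # w)"
    using 3 continuant_le_Cons[of b w] by (simp add: continuant_Cons_Cons)
  also have "\<dots> \<le> Suc a * (\<Prod>a\<leftarrow>b # w. Suc a)"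
    using 3 by (intro mult_left_mono) auto
  finally show ?case by simp
qed auto

text \<open>Passes from reversal classes to plain words, which are easier to weigh. A class is
  \<open>{x, rev x}\<close>, with a single element for palindromes, hence the factor 2.\<close>

lemma card_fibre_le_word_multiplicity:
  "card {x. mset x = mset w \<and> continuant x = continuant w} \<le> 2 * word_multiplicity w"
    (is "card ?F \<le> _")
proof -
  define C where "C = {X \<in> abelian_class w. \<exists>x\<in>X. continuant x = continuant w}"
  have fin: "finite C"
    using finite_abelian_class by (simp add: C_def)
  have two: "finite X \<and> card X \<le> 2" if "X \<in> C" for X
  proof -
    from that obtain x where "X = {x, rev x}"
      by (auto simp: C_def abelian_class_def reversal_rel_def elim!: quotientE)
    then show ?thesis
      by (auto simp: card_insert_if)
  qed
  have "?F \<subseteq> \<Union>C"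
  proof
    fix x assume x: "x \<in> ?F"
    then have "reversal_rel `` {x} \<in> abelian_class w"
      unfolding abelian_class_def by (intro quotientI) simp
    moreover have "x \<in> reversal_rel `` {x}"
      by (simp add: reversal_rel_def)
    ultimately show "x \<in> \<Union>C"
      using x unfolding C_def by blast
  qed
  then have "card ?F \<le> card (\<Union>C)"
    using fin two by (intro card_mono) auto
  also have "\<dots> \<le> (\<Sum>X\<in>C. card X)"
    by (rule card_Union_le_sum_card)
  also have "\<dots> \<le> card C * 2"
    using sum_bounded_above[of C card 2] two by simp
  finally show ?thesis
    by (simp add: C_def word_multiplicity_def)
qed

lemma finite_mset_eq: "finite {x. mset x = m}"
proof -
  have "{x. mset x = m} \<subseteq> {x. set x \<subseteq> set_mset m \<and> length x = size m}"
    by auto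
  then show ?thesis
    by (rule finite_subset) (simp add: finite_lists_length_eq)
qed

text \<open>Pigeonhole: the continuant takes at most \<open>P\<close> values on the rearrangements
  of \<open>m\<close>, and each value is shared by at most \<open>2 * M\<close> of them.\<close>

lemma card_abelian_class_words_le:
  assumes "0 \<notin># m" and mult: "\<And>w. mset w = m \<Longrightarrow> word_multiplicity w \<le> M"
  shows "card {x. mset x = m} \<le> 2 * M * (\<Prod>a\<in>#m. Suc a)"
proof -
  define P where "P = (\<Prod>a\<in>#m. Suc a)"
  define F where "F v = {x. mset x = m \<and> continuant x = v}" for v
  \<comment> \<open>A nonempty fibre supplies a word \<open>w\<close> with continuant
    \<open>v\<close>, whose multiplicity then bounds the whole fibre.\<close>
  have card_F: "card (F v) \<le> 2 * M" for v
  proof (cases "F v = {}")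
    case False
    then obtain w where "mset w = m" "continuant w = v"
      by (auto simp: F_def)
    then show ?thesis
      using card_fibre_le_word_multiplicity[of w] mult[of w] by (simp add: F_def)
  qed simp
  \<comment> \<open>Positive letters exclude the value 0, so there are \<open>P\<close> candidate
    values and not \<open>P + 1\<close>.\<close>
  have "{x. mset x = m} \<subseteq> (\<Union>v\<in>{1..P}. F v)"
  proof
    fix x assume "x \<in> {x. mset x = m}"
    then have x: "mset x = m" by simp
    then have "0 \<notin> set x" using assms(1) by auto
    moreover have "(\<Prod>a\<leftarrow>x. Suc a) = P"
      unfolding P_def x[symmetric] by (simp flip: prod_mset_prod_list)
    ultimately have "continuant x \<in> {1..P}"
      using continuant_pos[of x] continuant_le_prod[of x] by simp
    then show "x \<in> (\<Union>v\<in>{1..P}. F v)"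
      using x by (simp add: F_def)
  qed
  then have "card {x. mset x = m} \<le> card (\<Union>v\<in>{1..P}. F v)"
    by (intro card_mono finite_UN_I) (auto simp: F_def intro: finite_subset[OF _ finite_mset_eq])
  also have "\<dots> \<le> (\<Sum>v\<in>{1..P}. card (F v))"
    by (rule card_UN_le) simp
  also have "\<dots> \<le> P * (2 * M)"
    using sum_bounded_above[of "{1..P}" "\<lambda>v. card (F v)" "2 * M"] card_F by simp
  finally show ?thesis
    by (simp add: P_def mult_ac)
qed

text \<open>Expanding the power by distributivity, the choice of one summand from each of the
  \<open>n\<close> factors spells a word of length \<open>n\<close>.\<close>

lemma sum_prod_list_lists:
  fixes f :: "'a \<Rightarrow> 'b :: comm_semiring_1"
  assumes "finite A"
  shows "(\<Sum>x | set x \<subseteq> A \<and> length x = n. \<Prod>a\<leftarrow>x. f a) = (\<Sum>a\<in>A. f a) ^ n"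
proof (induction n)
  case 0
  have "{x. set x \<subseteq> A \<and> length x = 0} = {[]}" by auto
  then show ?case by simp
next
  case (Suc n)
  let ?W = "\<lambda>n. {x. set x \<subseteq> A \<and> length x = n}"
  have "?W (Suc n) = (\<lambda>(a, x). a # x) ` (A \<times> ?W n)"
    by (auto simp: length_Suc_conv)
  then have "(\<Sum>x\<in>?W (Suc n). \<Prod>a\<leftarrow>x. f a) = (\<Sum>(a, x)\<in>A \<times> ?W n. f a * (\<Prod>a\<leftarrow>x. f a))"
    by (subst sum.reindex_cong[where l = "\<lambda>(a, x). a # x" and B = "A \<times> ?W n"])
      (auto simp: inj_on_def)
  also have "\<dots> = (\<Sum>a\<in>A. f a) * (\<Sum>x\<in>?W n. \<Prod>a\<leftarrow>x. f a)"
    by (simp add: sum_product flip: sum.cartesian_product)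
  finally show ?case
    using Suc by simp
qed

lemma
  assumes "finite A"
  shows finite_multisets_size: "finite {m. set_mset m \<subseteq> A \<and> size m = n}" (is "finite ?S")
    and card_multisets_size_le: "card {m. set_mset m \<subseteq> A \<and> size m = n} \<le> Suc n ^ card A"
proof -
  \<comment> \<open>Restricting to \<open>A\<close> lands in a finite function space, and stays
    injective because counts vanish outside \<open>A\<close>.\<close>
  let ?g = "\<lambda>m. restrict (count m) A"
  have "?g ` ?S \<subseteq> A \<rightarrow>\<^sub>E {..n}"
    using count_le_size by (auto simp: PiE_def)
  moreover have "inj_on ?g ?S"
  proof (rule inj_onI)
    fix m m' assume m: "m \<in> ?S" "m' \<in> ?S" and eq: "?g m = ?g m'"
    have "count m a = count m' a" for a
    proof (cases "a \<in> A")
      case True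
      then show ?thesis using fun_cong[OF eq, of a] by simp
    next
      case False
      then have "a \<notin># m" "a \<notin># m'" using m by auto
      then show ?thesis by (simp add: not_in_iff)
    qed
    then show "m = m'" by (rule multiset_eqI)
  qed
  moreover have "finite (A \<rightarrow>\<^sub>E {..n})"
    using assms by (simp add: finite_PiE)
  ultimately have "finite ?S" "card ?S \<le> card (A \<rightarrow>\<^sub>E {..n})"
    by (blast intro: inj_on_finite card_inj_on_le)+
  then show "finite ?S" "card ?S \<le> Suc n ^ card A"
    using assms by (simp_all add: card_PiE)
qed

text \<open>The weight \<open>f x\<close> depends only on \<open>mset x\<close>. Grouping the words
  of length \<open>n\<close> by multiset, each group contributes its cardinality divided by
  \<open>P\<close>, at most \<open>2 * M\<close>.\<close>

lemma power_sum_inverse_le: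
  assumes fin: "finite A" and "0 \<notin> A"
    and mult: "\<And>w. set w \<subseteq> A \<Longrightarrow> word_multiplicity w \<le> M"
  shows "(\<Sum>a\<in>A. 1 / real (Suc a)) ^ n \<le> 2 * real M * real (Suc n) ^ card A"
proof -
  define W where "W = {x. set x \<subseteq> A \<and> length x = n}"
  define S where "S = {m. set_mset m \<subseteq> A \<and> size m = n}"
  define f where "f x = (\<Prod>a\<leftarrow>x. 1 / real (Suc a))" for x
  have f_eq: "f x = 1 / real (\<Prod>a\<in>#mset x. Suc a)" for x
    unfolding f_def by (induction x) (simp_all del: of_nat_Suc mult_Suc)
  have finW: "finite W"
    unfolding W_def using fin finite_lists_length_eq by blast
  have finS: "finite S"
    unfolding S_def using fin by (rule finite_multisets_size)
  have class_weight: "(\<Sum>x | x \<in> W \<and> mset x = m. f x) \<le> 2 * real M" if "m \<in> S" for m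
  proof -
    \<comment> \<open>The multiset \<open>m\<close> already fixes both the letters and the length,
      so the group is the full set of rearrangements.\<close>
    have eq: "{x. x \<in> W \<and> mset x = m} = {x. mset x = m}"
      using that by (auto simp: W_def S_def)
    define P where "P = (\<Prod>a\<in>#m. Suc a)"
    have "0 \<notin># m"
      using that \<open>0 \<notin> A\<close> by (auto simp: S_def)
    moreover have "word_multiplicity w \<le> M" if "mset w = m" for w
      using \<open>m \<in> S\<close> that by (intro mult) (auto simp: S_def)
    ultimately have "card {x. mset x = m} \<le> 2 * M * P"
      unfolding P_def by (rule card_abelian_class_words_le)
    then have "real (card {x. mset x = m}) \<le> 2 * real M * real P"
      by (metis of_nat_le_iff of_nat_mult of_nat_numeral)
    moreover have "P > 0"
      unfolding P_def by (induction m) auto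
    moreover have "(\<Sum>x | mset x = m. f x) = real (card {x. mset x = m}) / real P"
      by (simp add: f_eq P_def)
    ultimately show ?thesis
      unfolding eq by (simp add: pos_divide_le_eq)
  qed
  have "(\<Sum>a\<in>A. 1 / real (Suc a)) ^ n = (\<Sum>x\<in>W. f x)"
    unfolding W_def f_def by (rule sum_prod_list_lists[OF fin, symmetric])
  also have "\<dots> = (\<Sum>m\<in>S. \<Sum>x | x \<in> W \<and> mset x = m. f x)"
    using finW finS by (intro sum.group[symmetric]) (auto simp: W_def S_def)
  also have "\<dots> \<le> real (card S) * (2 * real M)"
    by (rule sum_bounded_above) (rule class_weight)
  also have "\<dots> \<le> real (Suc n) ^ card A * (2 * real M)"
  proof (rule mult_right_mono)
    show "real (card S) \<le> real (Suc n) ^ card A"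
      using card_multisets_size_le[OF fin, of n] unfolding S_def
      by (metis of_nat_le_iff of_nat_power)
  qed simp
  finally show ?thesis
    by (simp add: mult_ac)
qed

text \<open>With \<open>A\<close> and \<open>M\<close> fixed, a bound \<open>M\<close> on all
  multiplicities would keep the exponential \<open>c ^ n\<close> below a polynomial in
  \<open>n\<close>.\<close>

lemma exists_large_word_multiplicity:
  assumes "finite A" and "0 \<notin> A" and c: "(\<Sum>a\<in>A. 1 / real (Suc a)) > 1"
  shows "\<exists>w. set w \<subseteq> A \<and> word_multiplicity w > M"
proof (rule ccontr)
  assume neg: "\<not> ?thesis"
  define c N where "c = (\<Sum>a\<in>A. 1 / real (Suc a))" and "N = card A"
  have bound: "c ^ n \<le> 2 * real M * real (Suc n) ^ N" for n
    unfolding c_def N_def using neg by (intro power_sum_inverse_le assms) auto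
  have "c > 1" using c by (simp add: c_def)
  then have "(\<lambda>n. 2 * real M * (real n + 1) ^ N / c ^ n) \<longlonglongrightarrow> 0"
    by real_asymp
  then have "eventually (\<lambda>n. 2 * real M * (real n + 1) ^ N / c ^ n < 1) sequentially"
    by (rule order_tendstoD) simp
  then obtain n where "2 * real M * (real n + 1) ^ N / c ^ n < 1"
    by (auto dest: eventually_happens)
  then have "2 * real M * (real n + 1) ^ N < c ^ n"
    using \<open>c > 1\<close> by (simp add: divide_less_eq)
  with bound[of n] show False by (simp add: add.commute)
qed

lemma eventually_sum_inverse_gt:
  "eventually (\<lambda>s. (\<Sum>a=l+1..s. 1 / real (Suc a)) > C) sequentially"
proof -
  \<comment> \<open>The shift by 2 matches the summand \<open>1 / (s + 2)\<close> gained from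
    \<open>s\<close> to \<open>Suc s\<close>, which dominates the increment
    \<open>ln (1 + 1 / (s + 2))\<close>.\<close>
  have ln_le: "ln (real s + 2) - ln (real l + 2) \<le> (\<Sum>a=l+1..s. 1 / real (Suc a))" if "l \<le> s" for s
    using that
  proof (induction s rule: dec_induct)
    case (step s)
    have "1 + 1 / (real s + 2) = (real s + 3) / (real s + 2)"
      by (simp add: field_simps)
    then have "ln (real s + 3) - ln (real s + 2) = ln (1 + 1 / (real s + 2))"
      by (simp add: ln_div)
    also have "\<dots> \<le> 1 / (real s + 2)"
      by (rule ln_add_one_self_le_self) simp
    finally show ?case
      using step by (simp add: add_ac)
  qed simp
  have "filterlim (\<lambda>s. ln (real s + 2) - ln (real l + 2)) at_top sequentially"
    by real_asymp
  then have "eventually (\<lambda>s. ln (real s + 2) - ln (real l + 2) > C) sequentially"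
    by (simp add: filterlim_at_top_dense)
  then show ?thesis
    using eventually_ge_at_top[of l] by eventually_elim (use ln_le in force)
qed

theorem mainTheorem1:
  fixes t l :: nat and b :: "nat \<Rightarrow> nat"
  assumes "1 \<le> t" and "t \<le> l"
    and "strict_mono_on {1..t} b"
    and "\<forall>i\<in>{1..t}. 1 \<le> b i \<and> b i \<le> l"
  shows "\<exists>s0. \<forall>s>l. s \<ge> s0 \<longrightarrow>
    (\<exists>w :: nat \<Rightarrow> nat list.
      (\<forall>k. set (w k) \<subseteq> b ` {1..t} \<union> {l+1..s}) \<and>
      filterlim (\<lambda>k. word_multiplicity (w k)) at_top sequentially)"
proof -
  obtain s0 where s0: "\<And>s. s \<ge> s0 \<Longrightarrow> (\<Sum>a=l+1..s. 1 / real (Suc a)) > 1"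
    using eventually_sum_inverse_gt[of 1 l] by (auto simp: eventually_sequentially)
  have "\<exists>w :: nat \<Rightarrow> nat list.
      (\<forall>k. set (w k) \<subseteq> b ` {1..t} \<union> {l+1..s}) \<and>
      filterlim (\<lambda>k. word_multiplicity (w k)) at_top sequentially" if "s \<ge> s0" for s
  proof -
    \<comment> \<open>Asking for multiplicity above \<open>k\<close> at index \<open>k\<close> makes
      the chosen sequence diverge by comparison with the identity.\<close>
    have "\<forall>k. \<exists>w. set w \<subseteq> {l+1..s} \<and> word_multiplicity w > k"
      using s0[OF that] by (intro allI exists_large_word_multiplicity) auto
    then obtain w where w: "\<And>k. set (w k) \<subseteq> {l+1..s}" "\<And>k. word_multiplicity (w k) > k"
      by metis
    have "filterlim (\<lambda>k. word_multiplicity (w k)) at_top sequentially"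
      using filterlim_ident by (rule filterlim_at_top_mono) (simp add: w(2) less_imp_le)
    with w(1) show ?thesis by blast
  qed
  then show ?thesis by blast
qed

end
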